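(* Suppose there exist a $k$-GDD$_\lambda$ ${\cal D}=(V,{\cal G},{\cal B})$ with groups ${\cal G}=\{G_1,\dots,G_u\}$ and with chromatic number $\chi({\cal D})=c$, and a transversal design {\rm TD}$(k,w)$. Then there exists a $k$-GDD$_\lambda$ ${\cal D}^\times=(V^\times,{\cal G}^\times,{\cal B}^\times)$ with groups ${\cal G}^\times=\{G_1^\times,\dots,G_u^\times\}$, where $|G_i^\times|=w|G_i|$ for each $i$, and with chromatic number $\chi({\cal D}^\times)=c$.
   Context: A $k$-GDD$_\lambda$ is a triple $(V,{\cal G},{\cal B})$ where ${\cal G}$ partitions $V$ into groups, ${\cal B}$ is a collection of $k$-subsets (blocks) of $V$, no two points of the same group lie together in a block, and every pair of points from distinct groups lies in exactly $\lambda$ blocks. A transversal design {\rm TD}$(k,w)$ is a $k$-GDD$_1$ with $k$ groups each of size $w$. A weak $c$-colouring is a map from the points to a set of $c$ colours such that no block is monochromatic; the chromatic number $\chi$ of a design is the least $c$ admitting a weak $c$-colouring, and a design is $c$-chromatic if its chromatic number is $c$. *)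

theory Defs
  imports "HOL-Library.Multiset" "HOL-Library.Disjoint_Sets" "HOL-Library.FuncSet"
begin

(* Designs are finite; the groups are nonempty (this is part of partition_on).  The blocks form a
   multiset, since repeated blocks are allowed when the index l exceeds 1. *)
definition gdd :: "nat \<Rightarrow> nat \<Rightarrow> 'a set \<Rightarrow> 'a set set \<Rightarrow> 'a set multiset \<Rightarrow> bool" where
  "gdd k l V \<G> \<B> \<longleftrightarrow>
     finite V \<and> partition_on V \<G> \<and>
     (\<forall>B\<in>#\<B>. B \<subseteq> V \<and> card B = k) \<and>
     (\<forall>G\<in>\<G>. \<forall>x\<in>G. \<forall>y\<in>G. x \<noteq> y \<longrightarrow> (\<forall>B\<in>#\<B>. \<not> (x \<in> B \<and> y \<in> B))) \<and>
     (\<forall>G\<in>\<G>. \<forall>H\<in>\<G>. G \<noteq> H \<longrightarrow>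
        (\<forall>x\<in>G. \<forall>y\<in>H. size {#B \<in># \<B>. x \<in> B \<and> y \<in> B#} = l))"

(* For k > 0 the condition 0 < w is automatic, as groups are nonempty; for k = 0 it excludes the
   empty design from counting as a TD(0,0). *)
definition transversal_design ::
  "nat \<Rightarrow> nat \<Rightarrow> 'a set \<Rightarrow> 'a set set \<Rightarrow> 'a set multiset \<Rightarrow> bool" where
  "transversal_design k w V \<G> \<B> \<longleftrightarrow>
     0 < w \<and> gdd k 1 V \<G> \<B> \<and> card \<G> = k \<and> (\<forall>G\<in>\<G>. card G = w)"

definition monochromatic :: "('a \<Rightarrow> nat) \<Rightarrow> 'a set \<Rightarrow> bool" where
  "monochromatic f B \<longleftrightarrow> (\<exists>a. \<forall>x\<in>B. f x = a)"

definition weak_colouring :: "'a set \<Rightarrow> 'a set multiset \<Rightarrow> nat \<Rightarrow> ('a \<Rightarrow> nat) \<Rightarrow> bool" where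
  "weak_colouring V \<B> c f \<longleftrightarrow> f \<in> V \<rightarrow> {..<c} \<and> (\<forall>B\<in>#\<B>. \<not> monochromatic f B)"

(* A relation rather than a function: a design with a block of size 1 has no weak colouring,
   hence no chromatic number. *)
definition has_chromatic_number :: "'a set \<Rightarrow> 'a set multiset \<Rightarrow> nat \<Rightarrow> bool" where
  "has_chromatic_number V \<B> c \<longleftrightarrow>
     (\<exists>f. weak_colouring V \<B> c f) \<and> (\<forall>d. (\<exists>f. weak_colouring V \<B> d f) \<longrightarrow> c \<le> d)"

end

theory Submission
  imports Defs
begin

text \<open>
  Give every point weight \<open>w\<close> and replace each block \<open>B\<close> by the blocks of a copy of the transversal
  design on \<open>B \<times> {..<w}\<close> whose groups are the fibres \<open>{b} \<times> {..<w}\<close>. The new blocks are transversals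
  of these fibres, so they project onto old blocks and every colouring of the old design lifts. For
  the converse, label the points of the transversal design so that one of its blocks receives the
  constant label \<open>0\<close>: then \<open>V \<times> {0}\<close> carries a copy of the old design, and every colouring of the
  new design restricts to it.
\<close>

section \<open>Rules for group divisible designs and their relabelling\<close>

lemma gddD:
  assumes "gdd k l V \<G> \<B>"
  shows gdd_finite: "finite V"
    and gdd_partition_on: "partition_on V \<G>"
    and gdd_block_subset: "B \<in># \<B> \<Longrightarrow> B \<subseteq> V"
    and gdd_block_card: "B \<in># \<B> \<Longrightarrow> card B = k"
    and gdd_same_group:
      "H \<in> \<G> \<Longrightarrow> x \<in> H \<Longrightarrow> y \<in> H \<Longrightarrow> B \<in># \<B> \<Longrightarrow> x \<in> B \<Longrightarrow> y \<in> B \<Longrightarrow> x = y"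
    and gdd_distinct_groups:
      "G \<in> \<G> \<Longrightarrow> H \<in> \<G> \<Longrightarrow> G \<noteq> H \<Longrightarrow> x \<in> G \<Longrightarrow> y \<in> H \<Longrightarrow> size {#B \<in># \<B>. x \<in> B \<and> y \<in> B#} = l"
proof -
  note D = conjunct1[OF assms[unfolded gdd_def]] conjunct2[OF assms[unfolded gdd_def]]
  show "finite V" by (fact D(1))
  show "partition_on V \<G>" by (fact conjunct1[OF D(2)])
  note D' = conjunct2[OF D(2)]
  show "B \<subseteq> V" "card B = k" if "B \<in># \<B>"
    using bspec[OF conjunct1[OF D'] that] by (rule conjunct1, rule conjunct2)
  note D'' = conjunct2[OF D']
  show "x = y" if "H \<in> \<G>" "x \<in> H" "y \<in> H" "B \<in># \<B>" "x \<in> B" "y \<in> B"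
    using bspec[OF bspec[OF bspec[OF conjunct1[OF D''] that(1)] that(2)] that(3)] that(4-6) by blast
  show "size {#B \<in># \<B>. x \<in> B \<and> y \<in> B#} = l"
    if "G \<in> \<G>" "H \<in> \<G>" "G \<noteq> H" "x \<in> G" "y \<in> H"
    using bspec[OF bspec[OF conjunct2[OF D''] that(1)] that(2)] that(3-5) by blast
qed

lemma gddI:
  assumes "finite V" "partition_on V \<G>"
    and "\<And>B. B \<in># \<B> \<Longrightarrow> B \<subseteq> V" "\<And>B. B \<in># \<B> \<Longrightarrow> card B = k"
    and "\<And>H x y B. H \<in> \<G> \<Longrightarrow> x \<in> H \<Longrightarrow> y \<in> H \<Longrightarrow> B \<in># \<B> \<Longrightarrow> x \<in> B \<Longrightarrow> y \<in> B \<Longrightarrow> x = y"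
    and "\<And>G H x y. G \<in> \<G> \<Longrightarrow> H \<in> \<G> \<Longrightarrow> G \<noteq> H \<Longrightarrow> x \<in> G \<Longrightarrow> y \<in> H \<Longrightarrow>
      size {#B \<in># \<B>. x \<in> B \<and> y \<in> B#} = l"
  shows "gdd k l V \<G> \<B>"
  unfolding gdd_def
proof (intro conjI ballI impI notI)
  show "False" if "H \<in> \<G>" "x \<in> H" "y \<in> H" "x \<noteq> y" "B \<in># \<B>" "x \<in> B \<and> y \<in> B" for H x y B
    using assms(5)[of H x y B] that by simp
qed (fact assms(1,2) | erule assms(3,4) | rule assms(6); assumption)+

text \<open>Every clause of \<open>gdd\<close> is a matter of membership and counting inside
  \<open>V\<close>, which a relabelling that is injective on \<open>V\<close> preserves. This later
  moves a transversal design onto a prescribed point set.\<close>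

lemma gdd_image:
  assumes "gdd k l V \<G> \<B>" "inj_on f V"
  shows "gdd k l (f ` V) ((`) f ` \<G>) (image_mset ((`) f) \<B>)"
proof -
  note part = gdd_partition_on[OF assms(1)] and fin = gdd_finite[OF assms(1)]
    and same = gdd_same_group[OF assms(1)] and dist = gdd_distinct_groups[OF assms(1)]
  have bl: "B \<subseteq> V \<and> card B = k" if "B \<in># \<B>" for B
    using gdd_block_subset[OF assms(1) that] gdd_block_card[OF assms(1) that] by blast
  have sub: "G \<subseteq> V" if "G \<in> \<G>" for G
    using part that unfolding partition_on_def by blast
  have mem: "f x \<in> f ` B \<longleftrightarrow> x \<in> B" if "B \<in># \<B>" "x \<in> V" for x B
    using bl[OF that(1)] that(2) assms(2) by (meson inj_on_image_mem_iff)
  show ?thesis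
  proof (rule gddI)
    show "finite (f ` V)" using fin by simp
    have "{} \<notin> (`) f ` \<G>" using partition_onD3[OF part] by auto
    then show "partition_on (f ` V) ((`) f ` \<G>)"
      using partition_on_inj_image[OF part assms(2)] by simp
  next
    fix C assume "C \<in># image_mset ((`) f) \<B>"
    then obtain B where "B \<in># \<B>" "C = f ` B" by auto
    with bl[of B] assms(2) show "C \<subseteq> f ` V" "card C = k"
      by (auto simp: card_image inj_on_subset)
  next
    fix H' x' y' C
    assume prems: "H' \<in> (`) f ` \<G>" "x' \<in> H'" "y' \<in> H'" "C \<in># image_mset ((`) f) \<B>" "x' \<in> C" "y' \<in> C"
    obtain H where H: "H \<in> \<G>" "H' = f ` H" using prems(1) by blast
    obtain x y where xy: "x \<in> H" "x' = f x" "y \<in> H" "y' = f y" using H prems(2,3) by blast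
    obtain B where B: "B \<in># \<B>" "C = f ` B" using prems(4) by auto
    have "x \<in> B" "y \<in> B" using mem[OF B(1)] sub[OF H(1)] xy prems(5,6) B(2) by blast+
    then show "x' = y'" using same[OF H(1) xy(1,3) B(1)] xy by simp
  next
    fix G' H' x' y'
    assume prems: "G' \<in> (`) f ` \<G>" "H' \<in> (`) f ` \<G>" "G' \<noteq> H'" "x' \<in> G'" "y' \<in> H'"
    obtain G H where GH: "G \<in> \<G>" "G' = f ` G" "H \<in> \<G>" "H' = f ` H" using prems(1,2) by blast
    obtain x y where xy: "x \<in> G" "x' = f x" "y \<in> H" "y' = f y" using GH prems(4,5) by blast
    \<comment> \<open>The image multiset keeps multiplicities, so its pair count is the count of old
      blocks satisfying the pulled-back condition.\<close>
    have "filter_mset (\<lambda>B. f x \<in> f ` B \<and> f y \<in> f ` B) \<B> = filter_mset (\<lambda>B. x \<in> B \<and> y \<in> B) \<B>"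
      using mem sub[OF GH(1)] sub[OF GH(3)] xy by (intro filter_mset_cong) auto
    moreover have "G \<noteq> H" using prems(3) GH by blast
    ultimately show "size {#C \<in># image_mset ((`) f) \<B>. x' \<in> C \<and> y' \<in> C#} = l"
      using dist[OF GH(1,3) _ xy(1,3)] xy by (simp add: filter_mset_image_mset)
  qed
qed

section \<open>Transversal designs with prescribed groups and one prescribed block\<close>

text \<open>The \<open>k\<close> points of a block lie in pairwise different groups, and there are
  only \<open>k\<close> groups, so by counting no group is missed.\<close>

lemma transversal_design_block_meets_group:
  assumes "transversal_design k w X \<H> \<A>" "A \<in># \<A>" "H \<in> \<H>"
  shows "\<exists>x. A \<inter> H = {x}"
proof -
  have gdd: "gdd k 1 X \<H> \<A>" and card_H: "card \<H> = k"
    using assms(1) unfolding transversal_design_def by auto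
  note part = gdd_partition_on[OF gdd] and fin = gdd_finite[OF gdd]
    and A = gdd_block_subset[OF gdd assms(2)] gdd_block_card[OF gdd assms(2)]
  have same: "x = y" if "H \<in> \<H>" "x \<in> H" "y \<in> H" "x \<in> A" "y \<in> A" for H x y
    using gdd_same_group[OF gdd] that assms(2) by blast
  have finH: "finite \<H>" using finite_elements[OF fin part] .
  have "\<forall>x\<in>A. \<exists>H\<in>\<H>. x \<in> H" using A part unfolding partition_on_def by blast
  then obtain h where h: "\<And>x. x \<in> A \<Longrightarrow> h x \<in> \<H> \<and> x \<in> h x" by metis
  have "inj_on h A" by (rule inj_onI) (metis h same)
  then have "h ` A = \<H>"
    using h A card_H finH by (intro card_subset_eq) (auto simp: card_image)
  then obtain x where "x \<in> A" "x \<in> H" using h assms(3) by auto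
  then show ?thesis using same[OF assms(3)] by blast
qed

text \<open>Serves to number the points of a group so that its point on a chosen block gets the
  number 0.\<close>

lemma bij_betw_lessThan_zero_at:
  assumes "finite H" "card H = w" "a \<in> H"
  shows "\<exists>g. bij_betw g H {..<w} \<and> g a = 0"
proof -
  have "0 < w" using assms by (auto simp: card_gt_0_iff)
  have "card (H - {a}) = card {1..<w}" using assms by simp
  then obtain g where g: "bij_betw g (H - {a}) {1..<w}"
    using finite_same_card_bij[of "H - {a}" "{1..<w}"] assms(1) by auto
  have "bij_betw (g(a := 0)) (H - {a}) {1..<w}"
    using g bij_betw_cong[of "H - {a}" "g(a := 0)" g "{1..<w}"] by simp
  then have "bij_betw (g(a := 0)) ((H - {a}) \<union> {a}) ({1..<w} \<union> {0})"
    by (rule bij_betw_combine) (simp_all add: bij_betw_def)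
  moreover have "(H - {a}) \<union> {a} = H" "{1..<w} \<union> {0} = {..<w}"
    using assms \<open>0 < w\<close> by auto
  ultimately show ?thesis by (intro exI[of _ "g(a := 0)"]) auto
qed

text \<open>Match the groups with the points of \<open>B\<close> and number each group by
  \<open>{..<w}\<close>, starting at its point on a fixed block \<open>A\<close>. This relabelling
  turns \<open>A\<close> into \<open>B \<times> {0}\<close>. The bound \<open>2 \<le> k\<close>
  serves to produce such a block.\<close>

lemma transversal_design_on_product:
  assumes td: "transversal_design k w X \<H> \<A>" and "2 \<le> k" and B: "finite B" "card B = k"
  shows "\<exists>\<T>. transversal_design k w (B \<times> {..<w}) ((\<lambda>b. {b} \<times> {..<w}) ` B) \<T> \<and> B \<times> {0} \<in># \<T>"
proof -
  have gdd: "gdd k 1 X \<H> \<A>" and card_H: "card \<H> = k" and w: "0 < w"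
    and card_w: "\<And>H. H \<in> \<H> \<Longrightarrow> card H = w"
    using td unfolding transversal_design_def by auto
  note part = gdd_partition_on[OF gdd] and fin = gdd_finite[OF gdd]
  have finH: "finite \<H>" using finite_elements[OF fin part] .
  \<comment> \<open>Points of two different groups lie in exactly one common block, so the design
    has a block \<open>A\<close>.\<close>
  obtain H1 H2 where H12: "H1 \<in> \<H>" "H2 \<in> \<H>" "H1 \<noteq> H2"
    using card_H \<open>2 \<le> k\<close> by (metis card_le_Suc0_iff_eq finH not_less_eq_eq numeral_2_eq_2)
  then obtain x1 x2 where "x1 \<in> H1" "x2 \<in> H2" using card_w w by (metis card.empty ex_in_conv less_irrefl)
  then have "size {#A \<in># \<A>. x1 \<in> A \<and> x2 \<in> A#} = 1" using gdd_distinct_groups[OF gdd H12] by blast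
  then obtain A where A: "A \<in># \<A>" by (metis filter_empty_mset multiset_nonemptyE size_empty zero_neq_one)
  note AX = gdd_block_subset[OF gdd A]
  have "\<forall>H\<in>\<H>. \<exists>g. bij_betw g H {..<w} \<and> (\<forall>x\<in>A \<inter> H. g x = 0)"
  proof
    fix H assume H: "H \<in> \<H>"
    obtain a where a: "A \<inter> H = {a}" using transversal_design_block_meets_group[OF td A H] by blast
    have "finite H" using card_w[OF H] w card_gt_0_iff by metis
    with bij_betw_lessThan_zero_at[of H w a] card_w[OF H] a
    show "\<exists>g. bij_betw g H {..<w} \<and> (\<forall>x\<in>A \<inter> H. g x = 0)" by auto
  qed
  then obtain g where g: "\<And>H. H \<in> \<H> \<Longrightarrow> bij_betw (g H) H {..<w}"
    and g0: "\<And>H x. H \<in> \<H> \<Longrightarrow> x \<in> A \<Longrightarrow> x \<in> H \<Longrightarrow> g H x = 0" by (metis IntI)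
  obtain h where h: "bij_betw h \<H> B"
    using finite_same_card_bij[OF finH B(1)] card_H B by auto
  have "\<forall>x\<in>X. \<exists>H\<in>\<H>. x \<in> H" using part unfolding partition_on_def by blast
  then obtain p where p: "\<And>x. x \<in> X \<Longrightarrow> p x \<in> \<H> \<and> x \<in> p x" by metis
  have HX: "H \<subseteq> X" if "H \<in> \<H>" for H using that part unfolding partition_on_def by blast
  have p_eq: "p x = H" if "H \<in> \<H>" "x \<in> H" for x H
    using that part p[of x] HX[OF that(1)] unfolding partition_on_def disjoint_def by blast
  \<comment> \<open>Here \<open>p x\<close> is the unique group of \<open>x\<close>. The first
    coordinate names this group by a point of \<open>B\<close>; the second is the position of
    \<open>x\<close> within the group.\<close>
  define \<phi> where "\<phi> x = (h (p x), g (p x) x)" for x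
  have inj: "inj_on \<phi> X"
  proof (rule inj_onI)
    fix x y assume xy: "x \<in> X" "y \<in> X" "\<phi> x = \<phi> y"
    then have "p x = p y" using p h unfolding \<phi>_def bij_betw_def inj_on_def by blast
    with xy show "x = y" using p[of x] p[of y] g[of "p x"] unfolding \<phi>_def bij_betw_def inj_on_def by auto
  qed
  have img: "\<phi> ` H = {h H} \<times> {..<w}" if "H \<in> \<H>" for H
  proof -
    have "\<phi> ` H = (\<lambda>x. (h H, g H x)) ` H"
      using p_eq[OF that] unfolding \<phi>_def by (intro image_cong) auto
    also have "\<dots> = {h H} \<times> g H ` H" by auto
    finally show ?thesis using g[OF that] unfolding bij_betw_def by simp
  qed
  have groups: "(`) \<phi> ` \<H> = (\<lambda>b. {b} \<times> {..<w}) ` B"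
    using img h unfolding bij_betw_def by (auto simp: image_image intro!: image_cong)
  have points: "\<phi> ` X = B \<times> {..<w}"
  proof -
    have "\<phi> ` X = \<Union> ((`) \<phi> ` \<H>)" using part unfolding partition_on_def by blast
    then show ?thesis unfolding groups by auto
  qed
  \<comment> \<open>Points of \<open>A\<close> have number 0 in their groups, which gives one
    inclusion; both sides have \<open>k\<close> elements, so equality follows.\<close>
  have "\<phi> ` A = B \<times> {0}"
  proof (rule card_subset_eq)
    show "finite (B \<times> {0::nat})" using B by simp
    have "\<phi> ` A \<subseteq> B \<times> {..<w}" using AX points by blast
    then show "\<phi> ` A \<subseteq> B \<times> {0}" using g0 p AX unfolding \<phi>_def by auto
    show "card (\<phi> ` A) = card (B \<times> {0::nat})"
      using inj AX B gdd_block_card[OF gdd A] by (simp add: card_image inj_on_subset card_cartesian_product)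
  qed
  then have "B \<times> {0} \<in># image_mset ((`) \<phi>) \<A>" using A by (metis imageI set_image_mset)
  moreover have "card ((\<lambda>b. {b} \<times> {..<w}) ` B) = k"
    using B w by (subst card_image) (auto simp: inj_on_def)
  ultimately show ?thesis
    using gdd_image[OF gdd inj] w unfolding transversal_design_def groups points
    by (intro exI[of _ "image_mset ((`) \<phi>) \<A>"]) (auto simp: card_cartesian_product)
qed

section \<open>The design with every point replaced by \<open>w\<close> copies\<close>

lemma partition_on_Times_right:
  assumes "partition_on V \<G>" "W \<noteq> {}"
  shows "partition_on (V \<times> W) ((\<lambda>G. G \<times> W) ` \<G>)"
proof (rule partition_onI)
  show "\<Union> ((\<lambda>G. G \<times> W) ` \<G>) = V \<times> W"
    unfolding partition_onD1[OF assms(1)] by blast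
  fix p q assume pq: "p \<in> (\<lambda>G. G \<times> W) ` \<G>" "q \<in> (\<lambda>G. G \<times> W) ` \<G>" "p \<noteq> q"
  then obtain G H where GH: "G \<in> \<G>" "p = G \<times> W" "H \<in> \<G>" "q = H \<times> W" by blast
  with pq(3) have "G \<noteq> H" by blast
  then have "G \<inter> H = {}" using disjointD[OF partition_onD2[OF assms(1)] GH(1,3)] by blast
  then show "disjnt p q" using GH by (auto simp: disjnt_def)
next
  have "G \<times> W \<noteq> {}" if "G \<in> \<G>" for G
    using that assms(2) partition_onD3[OF assms(1)] by auto
  then show "{} \<notin> (\<lambda>G. G \<times> W) ` \<G>" unfolding image_iff by metis
qed

text \<open>Allows the new blocks through a pair of points to be counted one old block at a
  time.\<close>

lemma size_filter_sum_image_mset: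
  "size (filter_mset P (\<Sum>B\<in>#\<B>. T B)) = (\<Sum>B\<in>#\<B>. size (filter_mset P (T B)))"
  by (induction \<B>) auto

lemma sum_mset_indicator_eq_size_filter:
  "(\<Sum>B\<in>#\<B>. if P B then 1 else 0 :: nat) = size (filter_mset P \<B>)"
  by (induction \<B>) auto

text \<open>Two points of a new block in the same new group project to points of an old block in the
  same old group, so they share a fibre and then coincide. For points over different groups, each
  old block through both projections contributes exactly one new block, and any other old block
  none.\<close>

lemma gdd_product:
  assumes D: "gdd k l V \<G> \<B>" and w: "0 < w"
    and T: "\<And>B. B \<in># \<B> \<Longrightarrow> transversal_design k w (B \<times> {..<w}) ((\<lambda>b. {b} \<times> {..<w}) ` B) (T B)"
  shows "gdd k l (V \<times> {..<w}) ((\<lambda>G. G \<times> {..<w}) ` \<G>) (\<Sum>B\<in>#\<B>. T B)"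
proof -
  note part = gdd_partition_on[OF D] and fin = gdd_finite[OF D] and bl = gdd_block_subset[OF D]
    and same = gdd_same_group[OF D] and dist = gdd_distinct_groups[OF D]
  have T_gdd: "gdd k 1 (B \<times> {..<w}) ((\<lambda>b. {b} \<times> {..<w}) ` B) (T B)" if "B \<in># \<B>" for B
    using T[OF that] unfolding transversal_design_def by blast
  have T_block: "C \<subseteq> B \<times> {..<w} \<and> card C = k" if "B \<in># \<B>" "C \<in># T B" for B C
    using gdd_block_subset[OF T_gdd] gdd_block_card[OF T_gdd] that by metis
  \<comment> \<open>Both points lie in the fibre over \<open>b\<close>, which is a group of
    \<open>T B\<close>.\<close>
  have T_same: "i = j" if "B \<in># \<B>" "C \<in># T B" "(b, i) \<in> C" "(b, j) \<in> C" for B C b i j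
  proof -
    have "b \<in> B" "i < w" "j < w" using T_block[OF that(1,2)] that(3,4) by auto
    then show ?thesis
      using gdd_same_group[OF T_gdd[OF that(1)], of "{b} \<times> {..<w}" "(b, i)" "(b, j)" C] that by auto
  qed
  \<comment> \<open>The value 1 is the index of \<open>T B\<close> for points in different fibres;
    the value 0 arises because blocks of \<open>T B\<close> stay over \<open>B\<close>.\<close>
  have T_dist: "size {#C \<in># T B. (x, i) \<in> C \<and> (y, j) \<in> C#} = (if x \<in> B \<and> y \<in> B then 1 else 0)"
    if "B \<in># \<B>" "x \<noteq> y" "i < w" "j < w" for B x y i j
  proof (cases "x \<in> B \<and> y \<in> B")
    case True
    have "{x} \<times> {..<w} \<noteq> {y} \<times> {..<w}" using that by auto
    moreover have "(x, i) \<in> {x} \<times> {..<w}" "(y, j) \<in> {y} \<times> {..<w}" using that by auto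
    ultimately show ?thesis 
      using gdd_distinct_groups[OF T_gdd[OF that(1)], of "{x} \<times> {..<w}" "{y} \<times> {..<w}"] True by simp
  next
    case False
    then show ?thesis using T_block[OF that(1)] by auto
  qed
  show ?thesis
  proof (rule gddI)
    show "finite (V \<times> {..<w})" using fin by simp
    show "partition_on (V \<times> {..<w}) ((\<lambda>G. G \<times> {..<w}) ` \<G>)"
      using partition_on_Times_right[OF part, of "{..<w}"] w by (simp add: lessThan_empty_iff)
  next
    fix C assume "C \<in># (\<Sum>B\<in>#\<B>. T B)"
    then obtain B where B: "B \<in># \<B>" "C \<in># T B" by auto
    show "C \<subseteq> V \<times> {..<w}" "card C = k" using T_block[OF B] bl[OF B(1)] by blast+
  next
    fix G' p q C
    assume prems: "G' \<in> (\<lambda>G. G \<times> {..<w}) ` \<G>" "p \<in> G'" "q \<in> G'"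
      "C \<in># (\<Sum>B\<in>#\<B>. T B)" "p \<in> C" "q \<in> C"
    obtain G where G: "G \<in> \<G>" "fst p \<in> G" "fst q \<in> G" using prems(1-3) by auto
    obtain B where B: "B \<in># \<B>" "C \<in># T B" using prems(4) by auto
    have "fst p \<in> B" "fst q \<in> B" using T_block[OF B] prems(5,6) by auto
    then have "fst p = fst q" using same[OF G B(1)] by blast
    then show "p = q" using T_same[OF B] prems(5,6) by (metis prod.collapse)
  next
    fix G' H' p q
    assume prems: "G' \<in> (\<lambda>G. G \<times> {..<w}) ` \<G>" "H' \<in> (\<lambda>G. G \<times> {..<w}) ` \<G>" "G' \<noteq> H'" "p \<in> G'" "q \<in> H'"
    obtain G H where GH: "G \<in> \<G>" "H \<in> \<G>" "G \<noteq> H" and pq: "p \<in> G \<times> {..<w}" "q \<in> H \<times> {..<w}"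
      using prems by blast
    obtain x i y j where p: "p = (x, i)" "x \<in> G" "i < w" and q: "q = (y, j)" "y \<in> H" "j < w"
      using pq by auto
    \<comment> \<open>Distinct first coordinates make each term 0 or 1. Repeated old blocks are
      summed with multiplicity, so the total is the old pair count \<open>l\<close>.\<close>
    have "x \<noteq> y" using disjointD[OF partition_onD2[OF part] GH] p(2) q(2) by blast
    then have "(\<Sum>B\<in>#\<B>. size {#C \<in># T B. p \<in> C \<and> q \<in> C#})
        = (\<Sum>B\<in>#\<B>. if x \<in> B \<and> y \<in> B then 1 else 0)"
      using T_dist p q by (intro arg_cong[of _ _ sum_mset] image_mset_cong) auto
    then show "size {#C \<in># (\<Sum>B\<in>#\<B>. T B). p \<in> C \<and> q \<in> C#} = l"
      using dist[OF GH p(2) q(2)]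
      by (simp add: size_filter_sum_image_mset sum_mset_indicator_eq_size_filter)
  qed
qed

section \<open>Chromatic number of the new design\<close>

text \<open>Composition with \<open>fst\<close> lifts a colouring, and restriction to
  \<open>V \<times> {0}\<close> brings one back with the same colours, so neither design can be
  coloured with fewer colours than the other.\<close>

lemma has_chromatic_number_product:
  assumes chi: "has_chromatic_number V \<B> c" and w: "0 < w"
    and T: "\<And>B. B \<in># \<B> \<Longrightarrow> transversal_design k w (B \<times> {..<w}) ((\<lambda>b. {b} \<times> {..<w}) ` B) (T B)"
    and zero: "\<And>B. B \<in># \<B> \<Longrightarrow> B \<times> {0} \<in># T B"
  shows "has_chromatic_number (V \<times> {..<w}) (\<Sum>B\<in>#\<B>. T B) c"
  unfolding has_chromatic_number_def
proof (intro conjI allI impI)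
  obtain f where f: "f \<in> V \<rightarrow> {..<c}" "\<And>B. B \<in># \<B> \<Longrightarrow> \<not> monochromatic f B"
    using chi unfolding has_chromatic_number_def weak_colouring_def by blast
  have "\<not> monochromatic (f \<circ> fst) C" if B: "B \<in># \<B>" "C \<in># T B" for B C
  proof
    assume "monochromatic (f \<circ> fst) C"
    then obtain a where a: "\<And>p. p \<in> C \<Longrightarrow> f (fst p) = a" unfolding monochromatic_def by auto
    \<comment> \<open>The block \<open>C\<close> has a point over every \<open>b\<close> in
      \<open>B\<close>, so a constant colour on \<open>C\<close> would be constant on
      \<open>B\<close>.\<close>
    have "f b = a" if "b \<in> B" for b
    proof -
      obtain p where "C \<inter> ({b} \<times> {..<w}) = {p}"
        using transversal_design_block_meets_group[OF T[OF B(1)] B(2) imageI[OF \<open>b \<in> B\<close>]] by metis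
      then have "p \<in> C \<inter> ({b} \<times> {..<w})" by (simp only: singleton_iff)
      then have "p \<in> C" "fst p = b" by auto
      with a show ?thesis by blast
    qed
    then show False using f(2)[OF B(1)] unfolding monochromatic_def by blast
  qed
  then have "weak_colouring (V \<times> {..<w}) (\<Sum>B\<in>#\<B>. T B) c (f \<circ> fst)"
    using f(1) unfolding weak_colouring_def by (auto simp: Pi_def)
  then show "\<exists>f. weak_colouring (V \<times> {..<w}) (\<Sum>B\<in>#\<B>. T B) c f" by blast
next
  fix d assume "\<exists>f. weak_colouring (V \<times> {..<w}) (\<Sum>B\<in>#\<B>. T B) d f"
  then obtain f where f: "f \<in> V \<times> {..<w} \<rightarrow> {..<d}"
    and mono: "\<And>B C. B \<in># \<B> \<Longrightarrow> C \<in># T B \<Longrightarrow> \<not> monochromatic f C"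
    unfolding weak_colouring_def by auto
  \<comment> \<open>The restricted colours on \<open>B\<close> are those of \<open>f\<close> on the
    new block \<open>B \<times> {0}\<close>.\<close>
  have "\<not> monochromatic (\<lambda>x. f (x, 0)) B" if "B \<in># \<B>" for B
    using mono[OF that zero[OF that]] unfolding monochromatic_def by auto
  then have "weak_colouring V \<B> d (\<lambda>x. f (x, 0))"
    using f w unfolding weak_colouring_def by auto
  then show "c \<le> d" using chi unfolding has_chromatic_number_def by blast
qed

text \<open>A set with at most one point, the empty set included, is monochromatic under every
  map.\<close>

lemma weak_colouring_block_card_ge_2:
  assumes "weak_colouring V \<B> c f" "B \<in># \<B>" "finite B"
  shows "2 \<le> card B"
proof (rule ccontr)
  assume "\<not> 2 \<le> card B"
  then have "card B \<le> Suc 0" by simp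
  then have "\<forall>x\<in>B. \<forall>y\<in>B. x = y" using card_le_Suc0_iff_eq[OF assms(3)] by blast
  then have "monochromatic f B" unfolding monochromatic_def by metis
  then show False using assms unfolding weak_colouring_def by blast
qed

theorem theorem3p4:
  fixes k l w c u :: nat
    and V :: "'a set" and \<G> :: "'a set set" and \<B> :: "'a set multiset" and G :: "nat \<Rightarrow> 'a set"
    and X :: "'b set" and \<H> :: "'b set set" and \<A> :: "'b set multiset"
  assumes "gdd k l V \<G> \<B>"
    and "bij_betw G {1..u} \<G>"
    and "has_chromatic_number V \<B> c"
    and "transversal_design k w X \<H> \<A>"
  shows "\<exists>(V' :: ('a \<times> nat) set) \<G>' \<B>' G'.
           gdd k l V' \<G>' \<B>' \<and>
           bij_betw G' {1..u} \<G>' \<and>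
           (\<forall>i\<in>{1..u}. card (G' i) = w * card (G i)) \<and>
           has_chromatic_number V' \<B>' c"
proof -
  have w: "0 < w" using assms(4) by (simp add: transversal_design_def)
  have "\<exists>\<T>. transversal_design k w (B \<times> {..<w}) ((\<lambda>b. {b} \<times> {..<w}) ` B) \<T> \<and> B \<times> {0} \<in># \<T>"
    if "B \<in># \<B>" for B
  proof -
    have B: "finite B" "card B = k"
      using finite_subset[OF gdd_block_subset[OF assms(1) that] gdd_finite[OF assms(1)]]
        gdd_block_card[OF assms(1) that] by blast+
    \<comment> \<open>The bound \<open>2 \<le> k\<close> comes from the existence of a colouring
      together with the block \<open>B\<close> at hand; without blocks there is nothing to
      replace.\<close>
    moreover have "2 \<le> card B"
      using assms(3) weak_colouring_block_card_ge_2[OF _ that B(1)]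
      unfolding has_chromatic_number_def by blast
    ultimately show ?thesis using transversal_design_on_product[OF assms(4)] by blast
  qed
  then obtain T where
    T: "\<And>B. B \<in># \<B> \<Longrightarrow> transversal_design k w (B \<times> {..<w}) ((\<lambda>b. {b} \<times> {..<w}) ` B) (T B)"
    and zero: "\<And>B. B \<in># \<B> \<Longrightarrow> B \<times> {0} \<in># T B"
    by metis
  \<comment> \<open>Since \<open>0 < w\<close>, a group can be recovered from its product, so the
    indexing \<open>G\<close> carries over to the new groups.\<close>
  have "inj_on (\<lambda>G. G \<times> {..<w}) \<G>" using w by (auto simp: inj_on_def)
  then have "bij_betw (\<lambda>i. G i \<times> {..<w}) {1..u} ((\<lambda>G. G \<times> {..<w}) ` \<G>)"
    using bij_betw_trans[OF assms(2) inj_on_imp_bij_betw] by (simp add: comp_def)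
  moreover have "\<forall>i\<in>{1..u}. card (G i \<times> {..<w}) = w * card (G i)"
    by (simp add: card_cartesian_product)
  ultimately show ?thesis
    using gdd_product[OF assms(1) w T] has_chromatic_number_product[OF assms(3) w T zero] by blast
qed

end
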